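(* For every ergodic blind stochastic game $\Gamma=(\mathcal{K},\mathcal{I},\mathcal{J},p,g)$, the uniform value $v\colon\Delta(\mathcal{K})\to[0,1]$ of $\Gamma$ is independent of the initial belief: $v(b_1)=v(b_1')$ for all $b_1,b_1'\in\Delta(\mathcal{K})$.
   Context: For a finite set $\mathcal{C}$, $\Delta(\mathcal{C})$ is the set of probability distributions on $\mathcal{C}$. Blind stochastic game. A (two-player zero-sum) blind stochastic game is a tuple $\Gamma=(\mathcal{K},\mathcal{I},\mathcal{J},p,g)$, where $\mathcal{K}$ (states), $\mathcal{I}$ (actions of Player 1) and $\mathcal{J}$ (actions of Player 2) are finite nonempty sets, $p\colon\mathcal{K}\times\mathcal{I}\times\mathcal{J}\to\Delta(\mathcal{K})$ is the transition function, written $p(k'|k,i,j)=p(k,i,j)(k')$, and $g\colon\mathcal{K}\times\mathcal{I}\times\mathcal{J}\to[0,1]$ is the stage reward. For $(i,j)\in\mathcal{I}\times\mathcal{J}$, $P(i,j)=(p(k'|k,i,j))_{k,k'\in\mathcal{K}}$ is the transition matrix. Given an initial belief $b_1\in\Delta(\mathcal{K})$, the initial state $K_1$ is drawn from $b_1$. At each stage $m\ge1$ the players simultaneously choose actions $I_m\in\mathcal{I}$, $J_m\in\mathcal{J}$; the stage reward is $G_m=g(K_m,I_m,J_m)$ and $K_{m+1}$ is drawn from $p(K_m,I_m,J_m)$. The players know $b_1$ and observe past actions of both players, but observe neither states nor rewards. Let $\mathcal{H}_m=(\mathcal{I}\times\mathcal{J})^{m-1}$. A strategy of Player 1 is a map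 $\sigma\colon\bigcup_{m\ge1}\mathcal{H}_m\to\Delta(\mathcal{I})$ and a strategy of Player 2 is a map $\pi\colon\bigcup_{m\ge1}\mathcal{H}_m\to\Delta(\mathcal{J})$ (the two players randomize independently at each stage given the history); the strategy sets are $\Sigma$ and $\Pi$. $\mathbb{E}^{b_1}_{\sigma,\pi}$ denotes expectation under the law on plays induced by $(\sigma,\pi)$ and $b_1$. For $N\ge1$ let $\gamma_N^{b_1}(\sigma,\pi)=\mathbb{E}^{b_1}_{\sigma,\pi}\left(\frac1N\sum_{m=1}^N G_m\right)$. Uniform value. $\Gamma$ has a uniform value $v\colon\Delta(\mathcal{K})\to[0,1]$ if for all $b_1\in\Delta(\mathcal{K})$ and all $\varepsilon>0$ there exist $(\sigma^*,\pi^* )\in\Sigma\times\Pi$ and $\overline{n}\ge1$ such that for all $N\ge\overline{n}$ and all $(\sigma,\pi)\in\Sigma\times\Pi$: $\gamma_N^{b_1}(\sigma^*,\pi)\ge v(b_1)-\varepsilon$ and $\gamma_N^{b_1}(\sigma,\pi^* )\le v(b_1)+\varepsilon$. (Every ergodic blind stochastic game has a uniform value, which is then unique.) Ergodicity. For a stochastic matrix $P=(p_{k,k'})$ on $\mathcal{K}\times\mathcal{K}$ let $\tau_1(P)=\frac12\max_{k,\overline{k}\in\mathcal{K}}\sum_{k'\in\mathcal{K}}|p_{k,k'}-p_{\overline{k},k'}|$. For $a^n=(a_1,\dots,a_n)\in(\mathcal{I}\times\mathcal{J})^n$ let $T^n(a^n)=P(a_1)P(a_2)\cdots P(a_n)$.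 The game $\Gamma$ is ergodic if for all $\varepsilon>0$ there exists an integer $n_0$ such that for all $n\ge n_0$ and all $a^n\in(\mathcal{I}\times\mathcal{J})^n$, $\tau_1(T^n(a^n))\le\varepsilon$. *)

theory Defs
  imports "HOL-Probability.Probability"
begin

text \<open>
  The finite nonempty sets of states and actions are types of class \<open>finite\<close>.  A probability
  distribution on a finite set is a \<open>pmf\<close>, and a matrix indexed by states is a \<open>real ^ 'k ^ 'k\<close>
  whose rows are indexed by the current state.
\<close>

record ('k, 'i, 'j) game =
  trans :: "'k \<Rightarrow> 'i \<Rightarrow> 'j \<Rightarrow> 'k pmf"
  reward :: "'k \<Rightarrow> 'i \<Rightarrow> 'j \<Rightarrow> real"

definition blind_stochastic_game :: "('k::finite, 'i::finite, 'j::finite) game \<Rightarrow> bool" where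
  "blind_stochastic_game \<Gamma> \<longleftrightarrow> (\<forall>k i j. reward \<Gamma> k i j \<in> {0..1})"

text \<open>
  A public history lists the past action pairs in chronological order.  A history available at
  stage \<open>m\<close> has length \<open>m - 1\<close>, so the union of all the history sets is the whole list type.
\<close>

type_synonym ('i, 'j) history = "('i \<times> 'j) list"
type_synonym ('i, 'j) strategy1 = "('i, 'j) history \<Rightarrow> 'i pmf"
type_synonym ('i, 'j) strategy2 = "('i, 'j) history \<Rightarrow> 'j pmf"

text \<open>
  Joint law of the first \<open>m\<close> stages of the play, that is of the list of the triples
  \<open>(K_n, I_n, J_n)\<close> for \<open>n = 1, ..., m\<close>, together with the next state \<open>K_{m+1}\<close>.
  The strategies see only the projection of the past play to the action pairs.
\<close>

primrec play_law ::
    "('k, 'i, 'j) game \<Rightarrow> ('i, 'j) strategy1 \<Rightarrow> ('i, 'j) strategy2 \<Rightarrow> 'k pmf \<Rightarrow> nat \<Rightarrow>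
     (('k \<times> 'i \<times> 'j) list \<times> 'k) pmf" where
  "play_law \<Gamma> \<sigma> \<pi> b 0 = map_pmf (\<lambda>k. ([], k)) b"
| "play_law \<Gamma> \<sigma> \<pi> b (Suc m) =
     do {
       (h, k) \<leftarrow> play_law \<Gamma> \<sigma> \<pi> b m;
       i \<leftarrow> \<sigma> (map snd h);
       j \<leftarrow> \<pi> (map snd h);
       k' \<leftarrow> trans \<Gamma> k i j;
       return_pmf (h @ [(k, i, j)], k')
     }"

lemma length_play_law: "(h, k) \<in> set_pmf (play_law \<Gamma> \<sigma> \<pi> b m) \<Longrightarrow> length h = m"
  by (induction m arbitrary: h k) (auto simp: set_bind_pmf)

text \<open>
  The laws for different horizons are consistent: they are the finite-dimensional marginals of
  the law of the infinite play.
\<close>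

lemma play_law_consistent:
  "map_pmf (\<lambda>(h, k'). (butlast h, fst (last h))) (play_law \<Gamma> \<sigma> \<pi> b (Suc m)) = play_law \<Gamma> \<sigma> \<pi> b m"
  by (simp add: map_bind_pmf case_prod_beta bind_return_pmf')

definition payoff ::
    "('k, 'i, 'j) game \<Rightarrow> 'k pmf \<Rightarrow> nat \<Rightarrow> ('i, 'j) strategy1 \<Rightarrow> ('i, 'j) strategy2 \<Rightarrow> real" where
  "payoff \<Gamma> b N \<sigma> \<pi> =
     measure_pmf.expectation (play_law \<Gamma> \<sigma> \<pi> b N)
       (\<lambda>(h, _). 1 / real N * (\<Sum>m<N. case h ! m of (k, i, j) \<Rightarrow> reward \<Gamma> k i j))"

definition uniform_value ::
    "('k::finite, 'i::finite, 'j::finite) game \<Rightarrow> ('k pmf \<Rightarrow> real) \<Rightarrow> bool" where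
  "uniform_value \<Gamma> v \<longleftrightarrow>
     (\<forall>b. v b \<in> {0..1}) \<and>
     (\<forall>b. \<forall>\<epsilon>>0. \<exists>\<sigma>' \<pi>'. \<exists>n\<ge>1. \<forall>N\<ge>n. \<forall>\<sigma> \<pi>.
        payoff \<Gamma> b N \<sigma>' \<pi> \<ge> v b - \<epsilon> \<and> payoff \<Gamma> b N \<sigma> \<pi>' \<le> v b + \<epsilon>)"

definition trans_matrix :: "('k::finite, 'i, 'j) game \<Rightarrow> 'i \<times> 'j \<Rightarrow> real ^ 'k ^ 'k" where
  "trans_matrix \<Gamma> a = (\<chi> k k'. pmf (trans \<Gamma> k (fst a) (snd a)) k')"

primrec trans_prod :: "('k::finite, 'i, 'j) game \<Rightarrow> ('i \<times> 'j) list \<Rightarrow> real ^ 'k ^ 'k" where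
  "trans_prod \<Gamma> [] = mat 1"
| "trans_prod \<Gamma> (a # as) = trans_matrix \<Gamma> a ** trans_prod \<Gamma> as"

definition tau1 :: "real ^ 'k ^ 'k::finite \<Rightarrow> real" where
  "tau1 P = 1 / 2 * (MAX (k, l) \<in> UNIV. \<Sum>k'\<in>UNIV. \<bar>P $ k $ k' - P $ l $ k'\<bar>)"

definition ergodic :: "('k::finite, 'i::finite, 'j::finite) game \<Rightarrow> bool" where
  "ergodic \<Gamma> \<longleftrightarrow>
     (\<forall>\<epsilon>>0. \<exists>n0. \<forall>n\<ge>n0. \<forall>as. length as = n \<longrightarrow> tau1 (trans_prod \<Gamma> as) \<le> \<epsilon>)"

end

theory Submission
  imports Defs
begin

text \<open>
  The players observe actions only, so for fixed strategies the law of the public history does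
  not involve the initial belief, and conditionally on a public history \<open>as\<close> the current state
  is distributed according to the image of the initial belief under the product of the
  transition matrices along \<open>as\<close> (\<open>play_law_public\<close>).  Two initial beliefs are therefore mapped
  to distributions at \<open>\<ell>\<^sub>1\<close>-distance at most \<open>2 * tau1 (trans_prod \<Gamma> as)\<close> (\<open>belief_dist_le\<close>), which
  by ergodicity is small for every long history, uniformly in the strategies.  Averaging over
  the stages, \<open>N\<close>-stage payoffs from two initial beliefs are uniformly close for large \<open>N\<close>
  (\<open>payoff_asymptotically_independent\<close>).

  To compare \<open>v b\<close> with \<open>v b'\<close>, let Player 1 play \<open>\<epsilon>\<close>-optimally for \<open>b\<close> and Player 2
  \<open>\<epsilon>\<close>-optimally for \<open>b'\<close>: the payoff is at least \<open>v b - \<epsilon>\<close> from \<open>b\<close>, at most \<open>v b' + \<epsilon>\<close> from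
  \<open>b'\<close>, and the two payoffs are close.
\<close>

section \<open>Public histories and beliefs\<close>

text \<open>
  The law of the state after the action pairs \<open>as\<close>, listed in chronological order, when the initial
  state is drawn from \<open>b\<close>.
\<close>

definition belief_after :: "('k, 'i, 'j) game \<Rightarrow> 'k pmf \<Rightarrow> ('i \<times> 'j) list \<Rightarrow> 'k pmf" where
  "belief_after \<Gamma> b as = foldl (\<lambda>c a. bind_pmf c (\<lambda>k. trans \<Gamma> k (fst a) (snd a))) b as"

text \<open>The law of the public history of the first \<open>m\<close> stages; the states play no role in it.\<close>

primrec public_law :: "('i, 'j) strategy1 \<Rightarrow> ('i, 'j) strategy2 \<Rightarrow> nat \<Rightarrow> ('i, 'j) history pmf" where
  "public_law \<sigma> \<pi> 0 = return_pmf []"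
| "public_law \<sigma> \<pi> (Suc m) =
     do {
       as \<leftarrow> public_law \<sigma> \<pi> m;
       i \<leftarrow> \<sigma> as;
       j \<leftarrow> \<pi> as;
       return_pmf (as @ [(i, j)])
     }"

lemma length_public_law: "as \<in> set_pmf (public_law \<sigma> \<pi> m) \<Longrightarrow> length as = m"
  by (induction m arbitrary: as) (auto simp: set_bind_pmf)

lemma finite_set_public_law:
  fixes \<sigma> :: "('i::finite, 'j::finite) strategy1"
  shows "finite (set_pmf (public_law \<sigma> \<pi> m))"
  by (induction m) (auto simp: set_bind_pmf)

lemma finite_set_play_law:
  fixes \<Gamma> :: "('k::finite, 'i::finite, 'j::finite) game"
  shows "finite (set_pmf (play_law \<Gamma> \<sigma> \<pi> b m))"
  by (induction m) (auto simp: set_bind_pmf)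

text \<open>Disintegration of the play along the public history.\<close>

lemma play_law_public:
  "map_pmf (\<lambda>(h, k). (map snd h, k)) (play_law \<Gamma> \<sigma> \<pi> b m) =
     do {
       as \<leftarrow> public_law \<sigma> \<pi> m;
       k \<leftarrow> belief_after \<Gamma> b as;
       return_pmf (as, k)
     }"
proof (induction m)
  case 0
  show ?case
    by (simp add: belief_after_def map_pmf_def bind_return_pmf bind_assoc_pmf)
next
  case (Suc m)
  define step where "step = (\<lambda>(as, k).
    do {i \<leftarrow> \<sigma> as; j \<leftarrow> \<pi> as; k' \<leftarrow> trans \<Gamma> k i j; return_pmf (as @ [(i, j)], k')})"
  have "map_pmf (\<lambda>(h, k). (map snd h, k)) (play_law \<Gamma> \<sigma> \<pi> b (Suc m)) =
      bind_pmf (map_pmf (\<lambda>(h, k). (map snd h, k)) (play_law \<Gamma> \<sigma> \<pi> b m)) step"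
    by (simp add: map_bind_pmf bind_map_pmf step_def case_prod_beta)
  also have "\<dots> = do {as \<leftarrow> public_law \<sigma> \<pi> m; k \<leftarrow> belief_after \<Gamma> b as; step (as, k)}"
    unfolding Suc.IH by (simp add: bind_assoc_pmf bind_return_pmf)
  also have "\<dots> = do {as \<leftarrow> public_law \<sigma> \<pi> m; i \<leftarrow> \<sigma> as; j \<leftarrow> \<pi> as;
      k \<leftarrow> belief_after \<Gamma> b as; k' \<leftarrow> trans \<Gamma> k i j; return_pmf (as @ [(i, j)], k')}"
    unfolding step_def prod.case
    by (subst bind_commute_pmf, subst (2) bind_commute_pmf) (rule refl)
  also have "\<dots> = do {as \<leftarrow> public_law \<sigma> \<pi> (Suc m); k \<leftarrow> belief_after \<Gamma> b as; return_pmf (as, k)}"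
    by (simp add: bind_assoc_pmf bind_return_pmf belief_after_def)
  finally show ?case .
qed

section \<open>Contraction of beliefs\<close>

lemma pmf_belief_after:
  fixes \<Gamma> :: "('k::finite, 'i, 'j) game"
  shows "pmf (belief_after \<Gamma> b as) k = (\<Sum>k0\<in>UNIV. pmf b k0 * trans_prod \<Gamma> as $ k0 $ k)"
proof (induction as arbitrary: b)
  case Nil
  show ?case
    by (simp add: belief_after_def mat_def if_distrib cong: if_cong)
next
  case (Cons a as)
  have "pmf (belief_after \<Gamma> b (a # as)) k =
      (\<Sum>k1\<in>UNIV. (\<Sum>k0\<in>UNIV. pmf b k0 * pmf (trans \<Gamma> k0 (fst a) (snd a)) k1) * trans_prod \<Gamma> as $ k1 $ k)"
    using Cons[of "bind_pmf b (\<lambda>k. trans \<Gamma> k (fst a) (snd a))"]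
    by (simp add: belief_after_def pmf_bind integral_measure_pmf_real[of UNIV] mult.commute)
  also have "\<dots> = (\<Sum>k0\<in>UNIV. pmf b k0 * trans_prod \<Gamma> (a # as) $ k0 $ k)"
    unfolding sum_distrib_right
    by (subst sum.swap) (simp add: trans_matrix_def matrix_matrix_mult_def sum_distrib_left mult.assoc)
  finally show ?case .
qed

lemma tau1_ge:
  fixes P :: "real ^ 'k ^ 'k::finite"
  shows "(\<Sum>k\<in>UNIV. \<bar>P $ k0 $ k - P $ k1 $ k\<bar>) \<le> 2 * tau1 P"
proof -
  have "(\<lambda>(k, l). \<Sum>k'\<in>UNIV. \<bar>P $ k $ k' - P $ l $ k'\<bar>) (k0, k1)
      \<le> (MAX (k, l) \<in> UNIV. \<Sum>k'\<in>UNIV. \<bar>P $ k $ k' - P $ l $ k'\<bar>)"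
    by (intro Max_ge finite_imageI imageI) auto
  then show ?thesis
    by (simp add: tau1_def)
qed

text \<open>
  \<open>tau1\<close> compares rows, that is initial beliefs that are point masses; writing the difference of two mixtures of rows as a mixture,
  over pairs of rows, of differences extends the bound to arbitrary beliefs.
\<close>

lemma belief_dist_le:
  fixes \<Gamma> :: "('k::finite, 'i, 'j) game"
  shows "(\<Sum>k\<in>UNIV. \<bar>pmf (belief_after \<Gamma> b as) k - pmf (belief_after \<Gamma> b' as) k\<bar>)
    \<le> 2 * tau1 (trans_prod \<Gamma> as)"
proof -
  let ?T = "trans_prod \<Gamma> as"
  have one: "(\<Sum>k\<in>UNIV. pmf c k) = 1" for c :: "'k pmf"
    by (rule sum_pmf_eq_1) auto
  have diff: "pmf (belief_after \<Gamma> b as) k - pmf (belief_after \<Gamma> b' as) k =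
      (\<Sum>k0\<in>UNIV. \<Sum>k1\<in>UNIV. pmf b k0 * pmf b' k1 * (?T $ k0 $ k - ?T $ k1 $ k))" for k
  proof -
    have "(\<Sum>k0\<in>UNIV. pmf b k0 * ?T $ k0 $ k) =
        (\<Sum>k0\<in>UNIV. \<Sum>k1\<in>UNIV. pmf b k0 * pmf b' k1 * ?T $ k0 $ k)"
      by (simp add: one flip: sum_distrib_left sum_distrib_right)
    moreover have "(\<Sum>k1\<in>UNIV. pmf b' k1 * ?T $ k1 $ k) =
        (\<Sum>k0\<in>UNIV. \<Sum>k1\<in>UNIV. pmf b k0 * pmf b' k1 * ?T $ k1 $ k)"
      by (simp add: one mult.assoc flip: sum_distrib_left sum_distrib_right)
    ultimately show ?thesis
      by (simp add: pmf_belief_after right_diff_distrib sum_subtractf)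
  qed
  have "(\<Sum>k\<in>UNIV. \<bar>pmf (belief_after \<Gamma> b as) k - pmf (belief_after \<Gamma> b' as) k\<bar>)
      \<le> (\<Sum>k\<in>UNIV. \<Sum>k0\<in>UNIV. \<Sum>k1\<in>UNIV. pmf b k0 * pmf b' k1 * \<bar>?T $ k0 $ k - ?T $ k1 $ k\<bar>)"
    unfolding diff
    by (intro sum_mono order_trans[OF sum_abs]) (simp add: abs_mult)
  also have "\<dots> = (\<Sum>k0\<in>UNIV. \<Sum>k1\<in>UNIV. pmf b k0 * pmf b' k1 * (\<Sum>k\<in>UNIV. \<bar>?T $ k0 $ k - ?T $ k1 $ k\<bar>))"
    by (subst sum.swap, rule sum.cong[OF refl], subst sum.swap) (simp add: sum_distrib_left)
  also have "\<dots> \<le> (\<Sum>k0\<in>UNIV. \<Sum>k1\<in>UNIV. pmf b k0 * pmf b' k1 * (2 * tau1 ?T))"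
    by (intro sum_mono mult_left_mono tau1_ge) auto
  also have "\<dots> = 2 * tau1 ?T"
    by (simp add: one flip: sum_distrib_left sum_distrib_right)
  finally show ?thesis .
qed

section \<open>Stage rewards\<close>

text \<open>
  The law of the state and the action pair of stage \<open>m + 1\<close>: list positions start at 0.
\<close>

lemma play_law_nth:
  fixes \<Gamma> :: "('k, 'i, 'j) game"
  assumes "m < N"
  shows "map_pmf (\<lambda>(h, _). h ! m) (play_law \<Gamma> \<sigma> \<pi> b N) =
     do {
       as \<leftarrow> public_law \<sigma> \<pi> m;
       k \<leftarrow> belief_after \<Gamma> b as;
       i \<leftarrow> \<sigma> as;
       j \<leftarrow> \<pi> as;
       return_pmf (k, i, j)
     }"
proof -
  from assms have "Suc m \<le> N"
    by simp
  then show ?thesis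
  proof (induction N rule: dec_induct)
    case base
    define step where
      "step = (\<lambda>(as, k :: 'k). do {i \<leftarrow> \<sigma> as; j \<leftarrow> \<pi> as; return_pmf (k, i, j)})"
    have "map_pmf (\<lambda>(h, _). h ! m) (play_law \<Gamma> \<sigma> \<pi> b (Suc m)) =
        bind_pmf (play_law \<Gamma> \<sigma> \<pi> b m) (\<lambda>(h, k). step (map snd h, k))"
      by (auto simp: map_bind_pmf step_def case_prod_beta intro!: bind_pmf_cong
          dest!: length_play_law)
    also have "\<dots> = bind_pmf (map_pmf (\<lambda>(h, k). (map snd h, k)) (play_law \<Gamma> \<sigma> \<pi> b m)) step"
      by (simp add: bind_map_pmf case_prod_unfold)
    also have "\<dots> = do {as \<leftarrow> public_law \<sigma> \<pi> m; k \<leftarrow> belief_after \<Gamma> b as; step (as, k)}"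
      unfolding play_law_public by (simp add: bind_assoc_pmf bind_return_pmf)
    finally show ?case
      by (simp add: step_def)
  next
    case (step n)
    have "map_pmf (\<lambda>(h, _). h ! m) (play_law \<Gamma> \<sigma> \<pi> b (Suc n)) =
        bind_pmf (play_law \<Gamma> \<sigma> \<pi> b n) (\<lambda>(h, k). return_pmf (h ! m))"
      using step.hyps
      by (auto simp: map_bind_pmf case_prod_beta nth_append intro!: bind_pmf_cong
          dest!: length_play_law)
    also have "\<dots> = map_pmf (\<lambda>(h, _). h ! m) (play_law \<Gamma> \<sigma> \<pi> b n)"
      by (simp add: map_pmf_def case_prod_unfold)
    finally show ?case
      using step.IH by simp
  qed
qed

text \<open>The expected reward of stage \<open>m + 1\<close> given the public history \<open>as\<close> of the first \<open>m\<close> stages.\<close>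

definition cond_reward :: "('k, 'i, 'j) game \<Rightarrow> ('i, 'j) strategy1 \<Rightarrow> ('i, 'j) strategy2 \<Rightarrow> 'k pmf \<Rightarrow>
    ('i, 'j) history \<Rightarrow> real" where
  "cond_reward \<Gamma> \<sigma> \<pi> b as =
     measure_pmf.expectation (belief_after \<Gamma> b as) (\<lambda>k.
       measure_pmf.expectation (\<sigma> as) (\<lambda>i.
         measure_pmf.expectation (\<pi> as) (\<lambda>j. reward \<Gamma> k i j)))"

lemma expectation_bind_finite:
  fixes h :: "'b::finite \<Rightarrow> real"
  assumes "finite (set_pmf p)"
  shows "measure_pmf.expectation (bind_pmf p f) h =
    measure_pmf.expectation p (\<lambda>x. measure_pmf.expectation (f x) h)"
  using assms by (simp add: pmf_expectation_bind[OF assms] integral_measure_pmf[OF assms])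

lemma payoff_eq:
  fixes \<Gamma> :: "('k::finite, 'i::finite, 'j::finite) game"
  shows "payoff \<Gamma> b N \<sigma> \<pi> =
    (\<Sum>m<N. measure_pmf.expectation (public_law \<sigma> \<pi> m) (cond_reward \<Gamma> \<sigma> \<pi> b)) / real N"
proof -
  let ?r = "\<lambda>(k, i, j). reward \<Gamma> k i j"
  have "payoff \<Gamma> b N \<sigma> \<pi> =
      measure_pmf.expectation (play_law \<Gamma> \<sigma> \<pi> b N) (\<lambda>x. (\<Sum>m<N. ?r (fst x ! m)) / real N)"
    by (simp add: payoff_def case_prod_unfold)
  also have "\<dots> = (\<Sum>m<N. measure_pmf.expectation (play_law \<Gamma> \<sigma> \<pi> b N) (\<lambda>x. ?r (fst x ! m))) / real N"
    by (simp add: Bochner_Integration.integral_sum integrable_measure_pmf_finite finite_set_play_law)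
  also have "(\<Sum>m<N. measure_pmf.expectation (play_law \<Gamma> \<sigma> \<pi> b N) (\<lambda>x. ?r (fst x ! m))) =
      (\<Sum>m<N. measure_pmf.expectation (public_law \<sigma> \<pi> m) (cond_reward \<Gamma> \<sigma> \<pi> b))"
  proof (rule sum.cong[OF refl])
    fix m assume "m \<in> {..<N}"
    then have "m < N"
      by simp
    have "measure_pmf.expectation (play_law \<Gamma> \<sigma> \<pi> b N) (\<lambda>x. ?r (fst x ! m)) =
        measure_pmf.expectation (map_pmf (\<lambda>(h, _). h ! m) (play_law \<Gamma> \<sigma> \<pi> b N)) ?r"
      by (simp add: case_prod_beta)
    also have "\<dots> = measure_pmf.expectation (public_law \<sigma> \<pi> m) (cond_reward \<Gamma> \<sigma> \<pi> b)"
      unfolding play_law_nth[OF \<open>m < N\<close>] cond_reward_def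
      by (simp add: expectation_bind_finite finite_set_public_law)
    finally show "measure_pmf.expectation (play_law \<Gamma> \<sigma> \<pi> b N) (\<lambda>x. ?r (fst x ! m)) =
        measure_pmf.expectation (public_law \<sigma> \<pi> m) (cond_reward \<Gamma> \<sigma> \<pi> b)" .
  qed
  finally show ?thesis .
qed

lemma expectation_in_unit:
  fixes f :: "'a::finite \<Rightarrow> real"
  assumes "\<And>x. f x \<in> {0..1}"
  shows "measure_pmf.expectation p f \<in> {0..1}"
proof -
  have "measure_pmf.expectation p f \<le> measure_pmf.expectation p (\<lambda>_. 1)"
    using assms by (intro integral_mono integrable_measure_pmf_finite) auto
  moreover have "0 \<le> measure_pmf.expectation p f"
    using assms by (intro integral_nonneg_AE) auto
  ultimately show ?thesis
    by simp
qed

lemma cond_reward_in_unit: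
  fixes \<Gamma> :: "('k::finite, 'i::finite, 'j::finite) game"
  assumes "blind_stochastic_game \<Gamma>"
  shows "cond_reward \<Gamma> \<sigma> \<pi> b as \<in> {0..1}"
  unfolding cond_reward_def
  using assms by (intro expectation_in_unit) (simp add: blind_stochastic_game_def)

lemma cond_reward_diff_le:
  fixes \<Gamma> :: "('k::finite, 'i::finite, 'j::finite) game"
  assumes "blind_stochastic_game \<Gamma>"
  shows "\<bar>cond_reward \<Gamma> \<sigma> \<pi> b as - cond_reward \<Gamma> \<sigma> \<pi> b' as\<bar> \<le> 2 * tau1 (trans_prod \<Gamma> as)"
proof -
  define F where "F k = measure_pmf.expectation (\<sigma> as) (\<lambda>i.
      measure_pmf.expectation (\<pi> as) (\<lambda>j. reward \<Gamma> k i j))" for k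
  let ?B = "\<lambda>c. pmf (belief_after \<Gamma> c as)"
  have F: "F k \<in> {0..1}" for k
    unfolding F_def using assms by (intro expectation_in_unit) (simp add: blind_stochastic_game_def)
  have "cond_reward \<Gamma> \<sigma> \<pi> c as = (\<Sum>k\<in>UNIV. F k * ?B c k)" for c
    unfolding cond_reward_def F_def by (rule integral_measure_pmf_real) auto
  then have "\<bar>cond_reward \<Gamma> \<sigma> \<pi> b as - cond_reward \<Gamma> \<sigma> \<pi> b' as\<bar> =
      \<bar>\<Sum>k\<in>UNIV. F k * (?B b k - ?B b' k)\<bar>"
    by (simp add: right_diff_distrib sum_subtractf)
  also have "\<dots> \<le> (\<Sum>k\<in>UNIV. \<bar>F k * (?B b k - ?B b' k)\<bar>)"
    by (rule sum_abs)
  also have "\<dots> \<le> (\<Sum>k\<in>UNIV. \<bar>?B b k - ?B b' k\<bar>)"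
    using F by (intro sum_mono) (auto simp: abs_mult intro!: mult_left_le_one_le)
  also have "\<dots> \<le> 2 * tau1 (trans_prod \<Gamma> as)"
    by (rule belief_dist_le)
  finally show ?thesis .
qed

section \<open>Asymptotic independence of the initial belief\<close>

lemma expectation_diff_le:
  fixes f g :: "'a \<Rightarrow> real"
  assumes "finite (set_pmf p)" and "\<And>x. x \<in> set_pmf p \<Longrightarrow> \<bar>f x - g x\<bar> \<le> c"
  shows "\<bar>measure_pmf.expectation p f - measure_pmf.expectation p g\<bar> \<le> c"
proof -
  note int = integrable_measure_pmf_finite[OF assms(1)]
  have "\<bar>measure_pmf.expectation p f - measure_pmf.expectation p g\<bar> =
      \<bar>measure_pmf.expectation p (\<lambda>x. f x - g x)\<bar>"
    by (simp add: int)
  also have "\<dots> \<le> measure_pmf.expectation p (\<lambda>x. \<bar>f x - g x\<bar>)"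
    by (rule integral_abs_bound)
  also have "\<dots> \<le> measure_pmf.expectation p (\<lambda>_. c)"
    using assms(2) by (intro integral_mono_AE int) (simp add: AE_measure_pmf_iff)
  finally show ?thesis
    by simp
qed

text \<open>
  The threshold does not depend on the strategies: the first \<open>n0\<close> stages contribute at most
  \<open>n0 / N\<close> to the difference of the payoffs, every later stage at most \<open>\<epsilon> / (2 * N)\<close>.
\<close>

lemma payoff_asymptotically_independent:
  fixes \<Gamma> :: "('k::finite, 'i::finite, 'j::finite) game"
  assumes game: "blind_stochastic_game \<Gamma>" and erg: "ergodic \<Gamma>" and "\<epsilon> > 0"
  shows "\<exists>n. \<forall>N\<ge>n. \<forall>\<sigma> \<pi>. \<bar>payoff \<Gamma> b N \<sigma> \<pi> - payoff \<Gamma> b' N \<sigma> \<pi>\<bar> \<le> \<epsilon>"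
proof -
  obtain n0 where n0: "tau1 (trans_prod \<Gamma> as) \<le> \<epsilon> / 4" if "length as \<ge> n0" for as
    using erg \<open>\<epsilon> > 0\<close> unfolding ergodic_def by (metis zero_less_divide_iff zero_less_numeral)
  obtain n1 :: nat where n1: "real n0 / (\<epsilon> / 2) < real n1"
    using reals_Archimedean2 by blast
  have "\<bar>payoff \<Gamma> b N \<sigma> \<pi> - payoff \<Gamma> b' N \<sigma> \<pi>\<bar> \<le> \<epsilon>" if "N \<ge> Suc n1" for N \<sigma> \<pi>
  proof -
    define e where "e c m = measure_pmf.expectation (public_law \<sigma> \<pi> m) (cond_reward \<Gamma> \<sigma> \<pi> c)" for c m
    have stage: "\<bar>e b m - e b' m\<bar> \<le> (if m < n0 then 1 else 0) + \<epsilon> / 2" for m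
      unfolding e_def
    proof (rule expectation_diff_le[OF finite_set_public_law])
      fix as assume "as \<in> set_pmf (public_law \<sigma> \<pi> m)"
      then have "length as = m"
        by (rule length_public_law)
      then show "\<bar>cond_reward \<Gamma> \<sigma> \<pi> b as - cond_reward \<Gamma> \<sigma> \<pi> b' as\<bar> \<le> (if m < n0 then 1 else 0) + \<epsilon> / 2"
        using cond_reward_in_unit[OF game, of \<sigma> \<pi> b as] cond_reward_in_unit[OF game, of \<sigma> \<pi> b' as]
          cond_reward_diff_le[OF game, of \<sigma> \<pi> b as b'] n0[of as] \<open>\<epsilon> > 0\<close>
        by auto
    qed
    have "\<bar>(\<Sum>m<N. e b m) - (\<Sum>m<N. e b' m)\<bar> \<le> (\<Sum>m<N. \<bar>e b m - e b' m\<bar>)"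
      by (simp add: sum_abs flip: sum_subtractf)
    also have "\<dots> \<le> (\<Sum>m<N. (if m < n0 then 1 else 0) + \<epsilon> / 2)"
      by (intro sum_mono stage)
    also have "\<dots> = real (card ({..<N} \<inter> {m. m < n0})) + real N * (\<epsilon> / 2)"
      by (simp add: sum.distrib sum.If_cases)
    also have "\<dots> \<le> real n0 + real N * (\<epsilon> / 2)"
      using card_mono[of "{..<n0}" "{..<N} \<inter> {m. m < n0}"] by auto
    also have "\<dots> \<le> real N * \<epsilon>"
    proof -
      have "real n0 / (\<epsilon> / 2) \<le> real N"
        using n1 that by linarith
      then have "real n0 \<le> real N * (\<epsilon> / 2)"
        using \<open>\<epsilon> > 0\<close> by (simp add: pos_divide_le_eq)
      then show ?thesis
        by simp
    qed
    finally have "\<bar>(\<Sum>m<N. e b m) - (\<Sum>m<N. e b' m)\<bar> \<le> real N * \<epsilon>" .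
    moreover have "payoff \<Gamma> b N \<sigma> \<pi> - payoff \<Gamma> b' N \<sigma> \<pi> =
        ((\<Sum>m<N. e b m) - (\<Sum>m<N. e b' m)) / real N"
      by (simp add: payoff_eq e_def diff_divide_distrib)
    moreover have "N > 0"
      using that by simp
    ultimately show ?thesis
      by (simp add: abs_divide divide_le_eq mult.commute)
  qed
  then show ?thesis
    by blast
qed

lemma uniform_value_le:
  fixes \<Gamma> :: "('k::finite, 'i::finite, 'j::finite) game"
  assumes "blind_stochastic_game \<Gamma>" and "ergodic \<Gamma>" and v: "uniform_value \<Gamma> v"
  shows "v b \<le> v b'"
proof (rule field_le_epsilon)
  fix e :: real assume "e > 0"
  then have "e / 3 > 0"
    by simp
  obtain \<sigma> n1 where 1: "payoff \<Gamma> b N \<sigma> \<pi> \<ge> v b - e / 3" if "N \<ge> n1" for N \<pi>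
    using v \<open>e / 3 > 0\<close> unfolding uniform_value_def by meson
  obtain \<pi> n2 where 2: "payoff \<Gamma> b' N \<sigma>' \<pi> \<le> v b' + e / 3" if "N \<ge> n2" for N \<sigma>'
    using v \<open>e / 3 > 0\<close> unfolding uniform_value_def by meson
  obtain n3 where 3: "\<bar>payoff \<Gamma> b N \<sigma>' \<pi>' - payoff \<Gamma> b' N \<sigma>' \<pi>'\<bar> \<le> e / 3" if "N \<ge> n3" for N \<sigma>' \<pi>'
    using payoff_asymptotically_independent[OF assms(1,2) \<open>e / 3 > 0\<close>] by meson
  define N where "N = max n1 (max n2 n3)"
  have "N \<ge> n1" "N \<ge> n2" "N \<ge> n3"
    by (simp_all add: N_def)
  with 1[of N \<pi>] 2[of N \<sigma>] 3[of N \<sigma> \<pi>] show "v b \<le> v b' + e"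
    by linarith
qed

theorem theorem3p7:
  fixes \<Gamma> :: "('k::finite, 'i::finite, 'j::finite) game"
    and v :: "'k pmf \<Rightarrow> real"
  assumes "blind_stochastic_game \<Gamma>"
    and "ergodic \<Gamma>"
    and "uniform_value \<Gamma> v"
  shows "\<forall>b b'. v b = v b'"
  using uniform_value_le[OF assms] by (auto intro: antisym)

end
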